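(* Let $(\alpha,\beta)$ be a Bertrand curve pair in $\mathbb{R}^3$, $\beta=\alpha+\lambda N$, where $\alpha$ has Frenet frame $T,N,B$, curvature $\kappa$ and torsion $\tau$, and let $\theta$ be the angle with $T_\beta=\cos\theta\,T+\sin\theta\,B$. Let $\mu$ be the constant with $\lambda\kappa+\mu\tau=1$. Then, with respect to the normal connection $D^\perp$, the following hold. 1) The partner curve $\beta$ is weak biharmonic if and only if $$3\lambda\kappa\kappa'-\sin^2\theta\,\kappa'=0,\qquad \frac{(\lambda\kappa-\sin^2\theta)(1-\cos\theta)^2\kappa^2-\lambda\kappa''\sin^2\theta}{\mu\sin^3\theta}=0.$$ 2) The partner curve $\beta$ is of 1-type harmonic if and only if there is a constant $c\in\mathbb{R}$ such that $$3\lambda\kappa\kappa'-\sin^2\theta\,\kappa'=0,\qquad \frac{(\lambda\kappa-\sin^2\theta)(1-\cos\theta)^2\kappa^2-\lambda\kappa''\sin^2\theta}{\sin^2\theta}=c\,(\lambda\kappa-\sin^2\theta).$$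
   Context: Setting. $\alpha:I\to\mathbb{R}^3$ is a smooth unit speed curve with arc-length parameter $s$, Frenet frame $T,N,B$, curvature $\kappa>0$ and torsion $\tau>0$, with $T'=\kappa N$, $N'=-\kappa T+\tau B$, $B'=-\tau N$. A prime denotes $d/ds$. A Bertrand curve pair $(\alpha,\beta)$ consists of $\alpha$ and a curve $\beta$ having the same principal normal lines at corresponding points; then $\beta(s)=\alpha(s)+\lambda N(s)$ with $\lambda$ a real constant, and there is a real constant $\mu$ with $\lambda\kappa+\mu\tau=1$. It is assumed that $\lambda\neq0$ and $\mu\neq 0$. Put $\vartheta=\|\beta'(s)\|=\tau\sqrt{\lambda^2+\mu^2}$. The Frenet frame of $\beta$ is $T_\beta=\beta'/\vartheta=\cos\theta\,T+\sin\theta\,B$, $N_\beta=N$, $B_\beta=-\sin\theta\,T+\cos\theta\,B$, where $\theta$ is a constant angle with $\sin\theta\neq0$. The curvature of $\beta$ is $\kappa_\beta=\frac{\lambda\kappa-\sin^2\theta}{\lambda(1-\lambda\kappa)}$. The operators. On vector fields along $\alpha$, $D_B$ is the additive operator with $D_B(fX)=f'X+fD_BX$ for smooth functions $f$ of $s$, and $$D_BT=\frac{1-\cos\theta}{\sin\theta}\kappa N,\quad D_BN=-\frac{1-\cos\theta}{\sin\theta}\kappa T+\frac{1-\cos\theta}{\sin\theta}\tau B,\quad D_BB=-\frac{1-\cos\theta}{\sin\theta}\tau N.$$ The normal connection, acting on vector fields along $\alpha$ orthogonal to $B$, is $D^\perp_BX=D_BX-\langle D_BX,B\rangle B$. Harmonicity.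 The mean curvature vector of $\beta$ is $\mathbb{H}_\beta=\vartheta\kappa_\beta N_\beta=\frac{\lambda\kappa-\sin^2\theta}{\mu\sin\theta}N$, and its normal Laplacian is $\Delta^\perp\mathbb{H}_\beta=-D^\perp_BD^\perp_B\mathbb{H}_\beta$. With respect to $D^\perp$, $\beta$ is called weak biharmonic if $\Delta^\perp\mathbb{H}_\beta=0$ identically, and of 1-type harmonic if $\Delta^\perp\mathbb{H}_\beta=c\,\mathbb{H}_\beta$ for some constant $c\in\mathbb{R}$. *)

theory Defs
  imports "HOL-Analysis.Analysis"
begin

text \<open>Derivatives are taken within the parameter interval, hence one-sided at an end point that
  belongs to the interval. The values of a function outside \<open>I\<close> play no role.\<close>

definition deriv_on :: "real set \<Rightarrow> (real \<Rightarrow> 'a::real_normed_vector) \<Rightarrow> real \<Rightarrow> 'a" where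
  "deriv_on I f s = vector_derivative f (at s within I)"

definition smooth_on :: "real set \<Rightarrow> (real \<Rightarrow> 'a::real_normed_vector) \<Rightarrow> bool" where
  "smooth_on I f \<longleftrightarrow>
     (\<forall>n::nat. \<forall>s\<in>I. (deriv_on I ^^ n) f differentiable (at s within I))"

text \<open>\<open>(T, N, B)\<close> is a Frenet frame of the regular curve \<open>\<gamma>\<close> with curvature \<open>k\<close> and torsion \<open>t\<close>.
  The parameter need not be arc length, so the Frenet equations carry the speed as a factor.
  The sign of \<open>k\<close> is not restricted and \<open>k\<close> may vanish: the curvature of a Bertrand
  partner is taken with respect to the unit normal shared with the original curve. If \<open>k > 0\<close>,
  this is the usual, uniquely determined, Frenet frame of \<open>\<gamma>\<close>.\<close>

definition frenet_apparatus ::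
  "real set \<Rightarrow> (real \<Rightarrow> real^3) \<Rightarrow> (real \<Rightarrow> real^3) \<Rightarrow> (real \<Rightarrow> real^3) \<Rightarrow> (real \<Rightarrow> real^3) \<Rightarrow>
   (real \<Rightarrow> real) \<Rightarrow> (real \<Rightarrow> real) \<Rightarrow> bool" where
  "frenet_apparatus I \<gamma> T N B k t \<longleftrightarrow>
     smooth_on I \<gamma> \<and> smooth_on I T \<and> smooth_on I N \<and> smooth_on I B \<and>
     smooth_on I k \<and> smooth_on I t \<and>
     (\<forall>s\<in>I.
        norm (T s) = 1 \<and> norm (N s) = 1 \<and> T s \<bullet> N s = 0 \<and> B s = cross3 (T s) (N s) \<and>
        deriv_on I \<gamma> s \<noteq> 0 \<and>
        deriv_on I \<gamma> s = norm (deriv_on I \<gamma> s) *\<^sub>R T s \<and>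
        deriv_on I T s = (norm (deriv_on I \<gamma> s) * k s) *\<^sub>R N s \<and>
        deriv_on I N s = norm (deriv_on I \<gamma> s) *\<^sub>R (- k s *\<^sub>R T s + t s *\<^sub>R B s) \<and>
        deriv_on I B s = - (norm (deriv_on I \<gamma> s) * t s) *\<^sub>R N s)"

definition unit_speed :: "real set \<Rightarrow> (real \<Rightarrow> real^3) \<Rightarrow> bool" where
  "unit_speed I \<gamma> \<longleftrightarrow> (\<forall>s\<in>I. norm (deriv_on I \<gamma> s) = 1)"

definition principal_normal_line ::
  "(real \<Rightarrow> real^3) \<Rightarrow> (real \<Rightarrow> real^3) \<Rightarrow> real \<Rightarrow> (real^3) set" where
  "principal_normal_line \<gamma> N s = {\<gamma> s + r *\<^sub>R N s | r. True}"

definition bertrand_pair ::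
  "real set \<Rightarrow> (real \<Rightarrow> real^3) \<Rightarrow> (real \<Rightarrow> real^3) \<Rightarrow> (real \<Rightarrow> real^3) \<Rightarrow> (real \<Rightarrow> real^3) \<Rightarrow> bool" where
  "bertrand_pair I \<alpha> N\<^sub>\<alpha> \<beta> N\<^sub>\<beta> \<longleftrightarrow>
     (\<forall>s\<in>I. principal_normal_line \<alpha> N\<^sub>\<alpha> s = principal_normal_line \<beta> N\<^sub>\<beta> s)"

text \<open>The properties that determine the operator \<open>D\<^sub>B\<close> on smooth vector fields along the curve;
  existence is lemma \<open>D_B_operator_exists\<close> below.\<close>

definition is_D_B ::
  "real set \<Rightarrow> real \<Rightarrow> (real \<Rightarrow> real^3) \<Rightarrow> (real \<Rightarrow> real^3) \<Rightarrow> (real \<Rightarrow> real^3) \<Rightarrow>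
   (real \<Rightarrow> real) \<Rightarrow> (real \<Rightarrow> real) \<Rightarrow> ((real \<Rightarrow> real^3) \<Rightarrow> real \<Rightarrow> real^3) \<Rightarrow> bool" where
  "is_D_B I \<theta> T N B k t D \<longleftrightarrow>
     (\<forall>X Y. smooth_on I X \<longrightarrow> smooth_on I Y \<longrightarrow>
        (\<forall>s\<in>I. D (\<lambda>u. X u + Y u) s = D X s + D Y s)) \<and>
     (\<forall>f X. smooth_on I f \<longrightarrow> smooth_on I X \<longrightarrow>
        (\<forall>s\<in>I. D (\<lambda>u. f u *\<^sub>R X u) s = deriv_on I f s *\<^sub>R X s + f s *\<^sub>R D X s)) \<and>
     (\<forall>s\<in>I.
        D T s = ((1 - cos \<theta>) / sin \<theta> * k s) *\<^sub>R N s \<and>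
        D N s = - ((1 - cos \<theta>) / sin \<theta> * k s) *\<^sub>R T s + ((1 - cos \<theta>) / sin \<theta> * t s) *\<^sub>R B s \<and>
        D B s = - ((1 - cos \<theta>) / sin \<theta> * t s) *\<^sub>R N s)"

definition normal_connection ::
  "((real \<Rightarrow> real^3) \<Rightarrow> real \<Rightarrow> real^3) \<Rightarrow> (real \<Rightarrow> real^3) \<Rightarrow> (real \<Rightarrow> real^3) \<Rightarrow> real \<Rightarrow> real^3" where
  "normal_connection D B X s = D X s - (D X s \<bullet> B s) *\<^sub>R B s"

definition normal_laplacian ::
  "((real \<Rightarrow> real^3) \<Rightarrow> real \<Rightarrow> real^3) \<Rightarrow> (real \<Rightarrow> real^3) \<Rightarrow> (real \<Rightarrow> real^3) \<Rightarrow> real \<Rightarrow> real^3" where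
  "normal_laplacian D B X s = - normal_connection D B (normal_connection D B X) s"

definition mean_curvature_vector ::
  "real set \<Rightarrow> (real \<Rightarrow> real^3) \<Rightarrow> (real \<Rightarrow> real) \<Rightarrow> (real \<Rightarrow> real^3) \<Rightarrow> real \<Rightarrow> real^3" where
  "mean_curvature_vector I \<gamma> k N s = (norm (deriv_on I \<gamma> s) * k s) *\<^sub>R N s"

definition weak_biharmonic ::
  "real set \<Rightarrow> ((real \<Rightarrow> real^3) \<Rightarrow> real \<Rightarrow> real^3) \<Rightarrow> (real \<Rightarrow> real^3) \<Rightarrow> (real \<Rightarrow> real^3) \<Rightarrow> bool" where
  "weak_biharmonic I D B H \<longleftrightarrow> (\<forall>s\<in>I. normal_laplacian D B H s = 0)"

definition one_type_harmonic ::
  "real set \<Rightarrow> ((real \<Rightarrow> real^3) \<Rightarrow> real \<Rightarrow> real^3) \<Rightarrow> (real \<Rightarrow> real^3) \<Rightarrow> (real \<Rightarrow> real^3) \<Rightarrow> bool" where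
  "one_type_harmonic I D B H \<longleftrightarrow> (\<exists>c::real. \<forall>s\<in>I. normal_laplacian D B H s = c *\<^sub>R H s)"


lemma frame_expansion:
  fixes t n x :: "real^3"
  assumes "norm t = 1" "norm n = 1" "t \<bullet> n = 0"
  shows "(x \<bullet> t) *\<^sub>R t + (x \<bullet> n) *\<^sub>R n + (x \<bullet> cross3 t n) *\<^sub>R cross3 t n = x"
proof -
  define b where "b = cross3 t n"
  define y where "y = x - ((x \<bullet> t) *\<^sub>R t + (x \<bullet> n) *\<^sub>R n + (x \<bullet> b) *\<^sub>R b)"
  have tt: "t \<bullet> t = 1" "n \<bullet> n = 1" "n \<bullet> t = 0"
    using assms by (simp_all add: norm_eq_1 inner_commute)
  have b0: "b \<bullet> t = 0" "b \<bullet> n = 0" "t \<bullet> b = 0" "n \<bullet> b = 0"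
    by (simp_all add: b_def dot_cross_self)
  have bb: "b \<bullet> b = 1"
    using norm_cross[of t n] assms
    by (simp add: b_def power2_norm_eq_inner)
  have y: "y \<bullet> t = 0" "y \<bullet> n = 0" "y \<bullet> b = 0"
    using tt b0 bb assms(3) by (simp_all add: y_def inner_diff_left inner_add_left)
  have "cross3 y b = 0"
    by (simp add: b_def Lagrange y)
  with y(3) bb have "y = 0" using norm_and_cross_eq_0[of y b] by auto
  then show ?thesis by (simp add: y_def b_def)
qed

lemma D_B_operator_exists:
  assumes I: "is_interval I" "interior I \<noteq> {}"
    and fr: "frenet_apparatus I \<gamma> T N B k t"
  shows "\<exists>D. is_D_B I \<theta> T N B k t D"
proof -
  define a where "a = (1 - cos \<theta>) / sin \<theta>"
  define D where "D X s =
      deriv_on I (\<lambda>u. X u \<bullet> T u) s *\<^sub>R T s + deriv_on I (\<lambda>u. X u \<bullet> N u) s *\<^sub>R N s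
    + deriv_on I (\<lambda>u. X u \<bullet> B u) s *\<^sub>R B s
    + (X s \<bullet> T s) *\<^sub>R ((a * k s) *\<^sub>R N s)
    + (X s \<bullet> N s) *\<^sub>R (- (a * k s) *\<^sub>R T s + (a * t s) *\<^sub>R B s)
    + (X s \<bullet> B s) *\<^sub>R (- (a * t s) *\<^sub>R N s)" for X s
  have nb: "at s within I \<noteq> bot" if "s \<in> I" for s
  proof -
    have "\<nexists>x. I = {x}" using I(2) by auto
    then have "s islimpt I"
      using connected_imp_perfect[of I s] I(1) that is_interval_connected by blast
    then show ?thesis by (simp add: trivial_limit_within)
  qed
  have d0: "f differentiable (at s within I)"
    if "smooth_on I f" "s \<in> I" for f :: "real \<Rightarrow> 'b::real_normed_vector" and s
    using that funpow_0 unfolding smooth_on_def by metis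
  have dv: "(f has_vector_derivative deriv_on I f s) (at s within I)"
    if "f differentiable (at s within I)" for f :: "real \<Rightarrow> 'b::real_normed_vector" and s
    using that by (simp add: deriv_on_def vector_derivative_works)
  have un: "deriv_on I f s = d" if "(f has_vector_derivative d) (at s within I)" "s \<in> I"
    for f :: "real \<Rightarrow> 'b::real_normed_vector" and s d
    using that nb by (simp add: deriv_on_def vector_derivative_within)
  have cg: "deriv_on I f s = deriv_on I g s" if "\<And>u. u \<in> I \<Longrightarrow> f u = g u" "s \<in> I"
    for f g :: "real \<Rightarrow> real" and s
    unfolding deriv_on_def by (rule vector_derivative_cong_eq) (use that in \<open>auto simp: eventually_at_filter\<close>)
  have sT: "smooth_on I T" and sN: "smooth_on I N" and sB: "smooth_on I B"
    using fr by (auto simp: frenet_apparatus_def)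
  have on: "T s \<bullet> T s = 1" "N s \<bullet> N s = 1" "B s \<bullet> B s = 1" "T s \<bullet> N s = 0" "N s \<bullet> T s = 0"
       "T s \<bullet> B s = 0" "B s \<bullet> T s = 0" "N s \<bullet> B s = 0" "B s \<bullet> N s = 0" if "s \<in> I" for s
  proof -
    have 1: "norm (T s) = 1" "norm (N s) = 1" "T s \<bullet> N s = 0" "B s = cross3 (T s) (N s)"
      using fr that by (auto simp: frenet_apparatus_def)
    then have "(norm (B s))\<^sup>2 = 1" using norm_cross[of "T s" "N s"] by simp
    then have "B s \<bullet> B s = 1" by (simp add: power2_norm_eq_inner)
    with 1 show "T s \<bullet> T s = 1" "N s \<bullet> N s = 1" "B s \<bullet> B s = 1" "T s \<bullet> N s = 0" "N s \<bullet> T s = 0"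
       "T s \<bullet> B s = 0" "B s \<bullet> T s = 0" "N s \<bullet> B s = 0" "B s \<bullet> N s = 0"
      by (simp_all add: norm_eq_1 inner_commute dot_cross_self)
  qed
  have ex: "(x \<bullet> T s) *\<^sub>R T s + (x \<bullet> N s) *\<^sub>R N s + (x \<bullet> B s) *\<^sub>R B s = x" if "s \<in> I" for x s
    using fr that frame_expansion[of "T s" "N s" x] by (auto simp: frenet_apparatus_def)
  have di: "(\<lambda>u. X u \<bullet> E u) differentiable (at s within I)"
    if "smooth_on I X" "smooth_on I E" "s \<in> I" for X E :: "real \<Rightarrow> real^3" and s
    using d0 that by (intro differentiable_inner) auto
  have c0: "deriv_on I (\<lambda>u. X u \<bullet> E u) s = 0"
    if "\<And>u. u \<in> I \<Longrightarrow> X u \<bullet> E u = c" "s \<in> I" for X E :: "real \<Rightarrow> real^3" and s c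
  proof -
    have "deriv_on I (\<lambda>u. X u \<bullet> E u) s = deriv_on I (\<lambda>u. c) s" using that by (intro cg) auto
    also have "\<dots> = 0" using that by (intro un) auto
    finally show ?thesis .
  qed
  have add: "D (\<lambda>u. X u + Y u) s = D X s + D Y s"
    if "smooth_on I X" "smooth_on I Y" "s \<in> I" for X Y s
  proof -
    have "deriv_on I (\<lambda>u. (X u + Y u) \<bullet> E u) s
            = deriv_on I (\<lambda>u. X u \<bullet> E u) s + deriv_on I (\<lambda>u. Y u \<bullet> E u) s"
      if E: "smooth_on I E" for E
      unfolding inner_add_left using that \<open>s \<in> I\<close> \<open>smooth_on I X\<close> \<open>smooth_on I Y\<close>
      by (intro un has_vector_derivative_add dv di) auto
    from this[OF sT] this[OF sN] this[OF sB] show ?thesis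
      unfolding D_def by (simp add: inner_add_left scaleR_add_left algebra_simps)
  qed
  have leib: "D (\<lambda>u. f u *\<^sub>R X u) s = deriv_on I f s *\<^sub>R X s + f s *\<^sub>R D X s"
    if f: "smooth_on I f" and X: "smooth_on I X" and s: "s \<in> I" for f X s
  proof -
    have 1: "deriv_on I (\<lambda>u. (f u *\<^sub>R X u) \<bullet> E u) s
            = deriv_on I f s * (X s \<bullet> E s) + f s * deriv_on I (\<lambda>u. X u \<bullet> E u) s"
      if E: "smooth_on I E" for E
    proof (rule un)
      have "((\<lambda>u. f u * (X u \<bullet> E u)) has_vector_derivative
             (f s * deriv_on I (\<lambda>u. X u \<bullet> E u) s + deriv_on I f s * (X s \<bullet> E s))) (at s within I)"
        by (intro has_vector_derivative_mult dv di d0 f X E s)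
      then show "((\<lambda>u. (f u *\<^sub>R X u) \<bullet> E u) has_vector_derivative
             (deriv_on I f s * (X s \<bullet> E s) + f s * deriv_on I (\<lambda>u. X u \<bullet> E u) s)) (at s within I)"
        by (simp add: add.commute)
    qed (rule s)
    have "D (\<lambda>u. f u *\<^sub>R X u) s
        = deriv_on I f s *\<^sub>R ((X s \<bullet> T s) *\<^sub>R T s + (X s \<bullet> N s) *\<^sub>R N s + (X s \<bullet> B s) *\<^sub>R B s)
          + f s *\<^sub>R D X s"
      unfolding D_def 1[OF sT] 1[OF sN] 1[OF sB]
      by (simp add: scaleR_add_left scaleR_add_right scaleR_diff_right algebra_simps)
    then show ?thesis by (simp add: ex[OF s])
  qed
  have fT: "D T s = (a * k s) *\<^sub>R N s"
    and fN: "D N s = - (a * k s) *\<^sub>R T s + (a * t s) *\<^sub>R B s"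
    and fB: "D B s = - (a * t s) *\<^sub>R N s" if "s \<in> I" for s
    using on that by (simp_all add: D_def c0[of T T 1] c0[of N N 1] c0[of B B 1] c0[of T N 0]
        c0[of N T 0] c0[of T B 0] c0[of B T 0] c0[of N B 0] c0[of B N 0])
  have "is_D_B I \<theta> T N B k t D"
    unfolding is_D_B_def using add leib fT fN fB by (simp add: a_def)
  then show ?thesis by (rule exI[of _ D])
qed

end

theory Submission
  imports Defs
begin

text \<open>Comparing the two Frenet equations of \<open>\<beta>\<close> shows that its mean curvature vector is \<open>h N\<close> with
  \<open>h = (\<lambda>\<kappa> - sin\<^sup>2 \<theta>) / (\<mu> sin \<theta>)\<close>. Applying the normal connection twice with
  \<open>a = (1 - cos \<theta>) / sin \<theta>\<close> gives \<open>\<Delta>\<^sup>\<bottom> (h N) = a (2 h' \<kappa> + h \<kappa>') T + (a\<^sup>2 h \<kappa>\<^sup>2 - h'') N\<close>,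
  and both claims are read off the \<open>T\<close> and \<open>N\<close> components, since \<open>a \<noteq> 0\<close>.
  Since \<open>D\<^sub>B\<close> is an operator on functions on all of \<open>\<real>\<close>, its independence of the values
  outside the parameter interval is not built in but follows from the product rule.\<close>

section \<open>Derivatives within the parameter interval\<close>

lemma deriv_on_cong:
  assumes "\<And>u. u \<in> I \<Longrightarrow> f u = g u" "s \<in> I"
  shows "deriv_on I f s = deriv_on I g s"
  unfolding deriv_on_def
  by (rule vector_derivative_cong_eq) (use assms in \<open>auto simp: eventually_at_filter\<close>)

lemma differentiable_within_cong:
  assumes "\<And>u. u \<in> I \<Longrightarrow> f u = g u" "s \<in> I" "f differentiable (at s within I)"
  shows "g differentiable (at s within I)"
  using assms has_derivative_transform[of s I g f] unfolding differentiable_def by metis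

lemma has_vector_derivative_deriv_on:
  "f differentiable (at s within I) \<Longrightarrow> (f has_vector_derivative deriv_on I f s) (at s within I)"
  by (simp add: deriv_on_def vector_derivative_works)

text \<open>A nonempty interior excludes a one-point interval, and in a connected set with more than
  one point every point is a limit point.\<close>

lemma at_within_interval_ne_bot:
  fixes I :: "real set"
  assumes "is_interval I" "interior I \<noteq> {}" "s \<in> I"
  shows "at s within I \<noteq> bot"
proof -
  have "\<nexists>x. I = {x}" using assms(2) by auto
  then have "s islimpt I"
    using connected_imp_perfect[of I s] assms is_interval_connected by blast
  then show ?thesis by (simp add: trivial_limit_within)
qed

section \<open>Differentiability of finite order\<close>

text \<open>A truncation of \<open>smooth_on\<close> that allows induction on the order. The bound
  is strict, so order 0 imposes nothing and the base cases are trivial.\<close>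

definition differentiable_upto ::
  "nat \<Rightarrow> real set \<Rightarrow> (real \<Rightarrow> 'a::real_normed_vector) \<Rightarrow> bool" where
  "differentiable_upto n I f \<longleftrightarrow>
     (\<forall>k<n. \<forall>s\<in>I. (deriv_on I ^^ k) f differentiable (at s within I))"

lemma smooth_on_iff_upto: "smooth_on I f \<longleftrightarrow> (\<forall>n. differentiable_upto n I f)"
  unfolding smooth_on_def differentiable_upto_def by blast

lemma differentiable_upto_0 [simp]: "differentiable_upto 0 I f"
  by (simp add: differentiable_upto_def)

text \<open>The iterate is peeled from the inside, so that an induction passes from \<open>f\<close>
  to its derivative; the inductions below therefore keep the functions arbitrary.\<close>

lemma differentiable_upto_Suc:
  "differentiable_upto (Suc n) I f \<longleftrightarrow>
     (\<forall>s\<in>I. f differentiable (at s within I)) \<and> differentiable_upto n I (deriv_on I f)"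
  by (simp add: differentiable_upto_def All_less_Suc2 funpow_Suc_right del: funpow.simps)

lemma differentiable_upto_SucD: "differentiable_upto (Suc n) I f \<Longrightarrow> differentiable_upto n I f"
  by (simp add: differentiable_upto_def)

lemma differentiable_upto_cong:
  assumes "\<And>s. s \<in> I \<Longrightarrow> f s = g s" "differentiable_upto n I f"
  shows "differentiable_upto n I g"
  using assms
proof (induction n arbitrary: f g)
  case (Suc n)
  have "differentiable_upto n I (deriv_on I g)"
    by (rule Suc.IH[of "deriv_on I f"])
      (use Suc.prems in \<open>auto simp: differentiable_upto_Suc intro: deriv_on_cong\<close>)
  moreover have "\<forall>s\<in>I. g differentiable (at s within I)"
    using Suc.prems differentiable_within_cong[of I f g] by (simp add: differentiable_upto_Suc)
  ultimately show ?case by (simp add: differentiable_upto_Suc)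
qed simp

lemma smooth_on_cong:
  assumes "\<And>s. s \<in> I \<Longrightarrow> f s = g s" "smooth_on I f"
  shows "smooth_on I g"
  using assms differentiable_upto_cong unfolding smooth_on_iff_upto by metis

lemma smooth_on_differentiable:
  "smooth_on I f \<Longrightarrow> s \<in> I \<Longrightarrow> f differentiable (at s within I)"
  unfolding smooth_on_def using funpow_0 by metis

lemma smooth_on_deriv_on: "smooth_on I f \<Longrightarrow> smooth_on I (deriv_on I f)"
  unfolding smooth_on_iff_upto using differentiable_upto_Suc by blast

section \<open>Algebra of derivatives and smooth functions\<close>

context
  fixes I :: "real set"
  assumes ne_bot: "\<forall>s\<in>I. at s within I \<noteq> bot"
begin

text \<open>\<open>deriv_on\<close> selects some derivative within \<open>I\<close>; at a limit
  point of \<open>I\<close> there is at most one, which is why \<open>ne_bot\<close> is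
  assumed.\<close>

lemma deriv_on_eqI:
  "(f has_vector_derivative d) (at s within I) \<Longrightarrow> s \<in> I \<Longrightarrow> deriv_on I f s = d"
  using ne_bot by (simp add: deriv_on_def vector_derivative_within)

lemma deriv_on_add:
  assumes "f differentiable (at s within I)" "g differentiable (at s within I)" "s \<in> I"
  shows "deriv_on I (\<lambda>u. f u + g u) s = deriv_on I f s + deriv_on I g s"
  using assms by (intro deriv_on_eqI has_vector_derivative_add has_vector_derivative_deriv_on)

lemma deriv_on_scaleR:
  assumes "f differentiable (at s within I)" "X differentiable (at s within I)" "s \<in> I"
  shows "deriv_on I (\<lambda>u. f u *\<^sub>R X u) s = f s *\<^sub>R deriv_on I X s + deriv_on I f s *\<^sub>R X s"
  using assms
  by (intro deriv_on_eqI has_vector_derivative_scaleR has_vector_derivative_deriv_on)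
     (auto simp: has_real_derivative_iff_has_vector_derivative intro: has_vector_derivative_deriv_on)

lemma deriv_on_const: "s \<in> I \<Longrightarrow> deriv_on I (\<lambda>u. c) s = 0"
  by (intro deriv_on_eqI) auto

lemma smooth_on_const:
  fixes c :: "'b::real_normed_vector"
  shows "smooth_on I (\<lambda>u. c)"
proof -
  have "differentiable_upto n I (\<lambda>u. c)" for n and c :: 'b
  proof (induction n arbitrary: c)
    case (Suc n)
    \<comment> \<open>The derivative is known to be the constant 0 on \<open>I\<close> only, hence
      the passage through congruence.\<close>
    show ?case
      using Suc differentiable_upto_cong[of I "\<lambda>u. 0" "deriv_on I (\<lambda>u. c)" n] deriv_on_const
      by (auto simp: differentiable_upto_Suc)
  qed simp
  then show ?thesis by (simp add: smooth_on_iff_upto)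
qed

lemma differentiable_upto_add:
  assumes "differentiable_upto n I f" "differentiable_upto n I g"
  shows "differentiable_upto n I (\<lambda>u. f u + g u)"
  using assms
proof (induction n arbitrary: f g)
  case (Suc n)
  have "differentiable_upto n I (deriv_on I (\<lambda>u. f u + g u))"
    by (rule differentiable_upto_cong[OF _ Suc.IH[of "deriv_on I f" "deriv_on I g"]])
       (use Suc.prems in \<open>auto simp: differentiable_upto_Suc deriv_on_add\<close>)
  with Suc.prems show ?case by (simp add: differentiable_upto_Suc)
qed simp

text \<open>The product rule gives a sum of two products, each of one factor with the derivative of
  the other. All four functions are differentiable up to order \<open>n\<close>, so the induction
  hypothesis covers both products.\<close>

lemma differentiable_upto_scaleR:
  fixes X :: "real \<Rightarrow> 'b::real_normed_vector"
  assumes "differentiable_upto n I f" "differentiable_upto n I X"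
  shows "differentiable_upto n I (\<lambda>u. f u *\<^sub>R X u)"
  using assms
proof (induction n arbitrary: f X)
  case (Suc n)
  have "differentiable_upto n I (\<lambda>u. f u *\<^sub>R deriv_on I X u + deriv_on I f u *\<^sub>R X u)"
    using Suc.prems Suc.prems[THEN differentiable_upto_SucD]
    by (intro differentiable_upto_add Suc.IH) (simp_all add: differentiable_upto_Suc)
  then have "differentiable_upto n I (deriv_on I (\<lambda>u. f u *\<^sub>R X u))"
    by (rule differentiable_upto_cong[rotated])
       (use Suc.prems in \<open>simp add: differentiable_upto_Suc deriv_on_scaleR\<close>)
  with Suc.prems show ?case by (simp add: differentiable_upto_Suc)
qed simp

lemma smooth_on_add: "smooth_on I f \<Longrightarrow> smooth_on I g \<Longrightarrow> smooth_on I (\<lambda>u. f u + g u)"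
  by (simp add: smooth_on_iff_upto differentiable_upto_add)

lemma smooth_on_scaleR: "smooth_on I f \<Longrightarrow> smooth_on I X \<Longrightarrow> smooth_on I (\<lambda>u. f u *\<^sub>R X u)"
  by (simp add: smooth_on_iff_upto differentiable_upto_scaleR)

lemma smooth_on_mult:
  fixes f g :: "real \<Rightarrow> real"
  shows "smooth_on I f \<Longrightarrow> smooth_on I g \<Longrightarrow> smooth_on I (\<lambda>u. f u * g u)"
  using smooth_on_scaleR[of f g] by simp

lemma deriv_on_mult:
  fixes f g :: "real \<Rightarrow> real"
  assumes "smooth_on I f" "smooth_on I g" "s \<in> I"
  shows "deriv_on I (\<lambda>u. f u * g u) s = f s * deriv_on I g s + deriv_on I f s * g s"
  using deriv_on_scaleR[of f s g] assms by (simp add: smooth_on_differentiable)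

lemma deriv_on_cmult:
  fixes f :: "real \<Rightarrow> real"
  assumes "smooth_on I f" "s \<in> I"
  shows "deriv_on I (\<lambda>u. c * f u) s = c * deriv_on I f s"
  using deriv_on_mult[of "\<lambda>u. c" f s] assms by (simp add: smooth_on_const deriv_on_const)

section \<open>The operator \<open>D\<close> and the normal Laplacian\<close>

text \<open>If \<open>X = Y\<close> on \<open>I\<close>, then \<open>X - Y\<close> equals its product with the indicator function of the
  complement of \<open>I\<close>, and the product rule gives \<open>D (X - Y) = 0\<close> on \<open>I\<close>.\<close>

lemma is_D_B_cong:
  assumes D: "is_D_B I \<theta> T N B k t D"
    and XY: "\<And>u. u \<in> I \<Longrightarrow> X u = Y u" and Y: "smooth_on I Y" and s: "s \<in> I"
  shows "D X s = D Y s"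
proof -
  define Z where "Z u = X u - Y u" for u
  define f :: "real \<Rightarrow> real" where "f u = (if u \<in> I then 0 else 1)" for u
  have Z: "smooth_on I Z"
    by (rule smooth_on_cong[OF _ smooth_on_const[of 0]]) (simp add: Z_def XY)
  have f: "smooth_on I f"
    by (rule smooth_on_cong[OF _ smooth_on_const[of 0]]) (simp add: f_def)
  have "deriv_on I f s = deriv_on I (\<lambda>u. 0) s"
    using s by (intro deriv_on_cong) (auto simp: f_def)
  moreover have "(\<lambda>u. f u *\<^sub>R Z u) = Z"
    by (auto simp: f_def Z_def XY)
  moreover have "D (\<lambda>u. f u *\<^sub>R Z u) s = deriv_on I f s *\<^sub>R Z s + f s *\<^sub>R D Z s"
    using D f Z s unfolding is_D_B_def by blast
  ultimately have "D Z s = 0"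
    using s by (simp add: deriv_on_const f_def)
  moreover have "D (\<lambda>u. Y u + Z u) s = D Y s + D Z s"
    using D Y Z s unfolding is_D_B_def by blast
  moreover have "(\<lambda>u. Y u + Z u) = X"
    by (simp add: Z_def)
  ultimately show ?thesis by simp
qed

text \<open>The only \<open>B\<close> component of \<open>D X\<close> comes from \<open>D N\<close>,
  and the projection removes it. The result again lies in the span of \<open>T\<close> and
  \<open>N\<close>, so the formula can be iterated; for this \<open>X\<close> may be given by its
  components on \<open>I\<close> alone.\<close>

lemma normal_connection_TN:
  assumes D: "is_D_B I \<theta> T N B k t D"
    and fr: "frenet_apparatus I \<gamma> T N B k t"
    and f: "smooth_on I f" and g: "smooth_on I g"
    and X: "\<And>u. u \<in> I \<Longrightarrow> X u = f u *\<^sub>R T u + g u *\<^sub>R N u"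
    and s: "s \<in> I"
    and a: "a = (1 - cos \<theta>) / sin \<theta>"
  shows "normal_connection D B X s =
    (deriv_on I f s - a * k s * g s) *\<^sub>R T s + (deriv_on I g s + a * k s * f s) *\<^sub>R N s"
proof -
  have T: "smooth_on I T" and N: "smooth_on I N" and Bs: "B s = cross3 (T s) (N s)"
    and n: "norm (T s) = 1" "norm (N s) = 1" "T s \<bullet> N s = 0"
    using fr s by (auto simp: frenet_apparatus_def)
  have "D X s = D (\<lambda>u. f u *\<^sub>R T u + g u *\<^sub>R N u) s"
    by (intro is_D_B_cong[OF D X] smooth_on_add smooth_on_scaleR f g T N s)
  also have "\<dots> = D (\<lambda>u. f u *\<^sub>R T u) s + D (\<lambda>u. g u *\<^sub>R N u) s"
    using D s smooth_on_scaleR[OF f T] smooth_on_scaleR[OF g N] unfolding is_D_B_def by blast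
  also have "D (\<lambda>u. f u *\<^sub>R T u) s = deriv_on I f s *\<^sub>R T s + f s *\<^sub>R D T s"
    using D s f T unfolding is_D_B_def by blast
  also have "D (\<lambda>u. g u *\<^sub>R N u) s = deriv_on I g s *\<^sub>R N s + g s *\<^sub>R D N s"
    using D s g N unfolding is_D_B_def by blast
  also have "D T s = (a * k s) *\<^sub>R N s"
    using D s unfolding is_D_B_def a by blast
  also have "D N s = - (a * k s) *\<^sub>R T s + (a * t s) *\<^sub>R B s"
    using D s unfolding is_D_B_def a by blast
  finally have DX: "D X s = (deriv_on I f s - a * k s * g s) *\<^sub>R T s
      + (deriv_on I g s + a * k s * f s) *\<^sub>R N s + (a * t s * g s) *\<^sub>R B s"
    by (simp add: algebra_simps)
  have "B s \<bullet> B s = 1"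
    using norm_cross[of "T s" "N s"] n by (simp add: Bs power2_norm_eq_inner)
  moreover have "T s \<bullet> B s = 0" "N s \<bullet> B s = 0"
    by (simp_all add: Bs dot_cross_self)
  ultimately have "D X s \<bullet> B s = a * t s * g s"
    by (simp add: DX inner_add_left)
  then show ?thesis
    unfolding normal_connection_def by (simp add: DX)
qed

lemma normal_laplacian_N:
  assumes D: "is_D_B I \<theta> T N B k t D"
    and fr: "frenet_apparatus I \<gamma> T N B k t"
    and h: "smooth_on I h"
    and X: "\<And>u. u \<in> I \<Longrightarrow> X u = h u *\<^sub>R N u"
    and s: "s \<in> I"
    and a: "a = (1 - cos \<theta>) / sin \<theta>"
  shows "normal_laplacian D B X s =
    (a * (2 * deriv_on I h s * k s + h s * deriv_on I k s)) *\<^sub>R T s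
    + (a\<^sup>2 * h s * (k s)\<^sup>2 - deriv_on I (deriv_on I h) s) *\<^sub>R N s"
proof -
  have k: "smooth_on I k"
    using fr by (simp add: frenet_apparatus_def)
  have hk: "smooth_on I (\<lambda>u. h u * k u)"
    by (intro smooth_on_mult h k)
  \<comment> \<open>First application, with components 0 and \<open>h\<close>.\<close>
  have 1: "normal_connection D B X u
      = (- a * (h u * k u)) *\<^sub>R T u + deriv_on I h u *\<^sub>R N u" if "u \<in> I" for u
    using normal_connection_TN[OF D fr smooth_on_const[of 0] h _ that a, of X] X that
    by (simp add: deriv_on_const mult.commute mult.left_commute)
  have 2: "deriv_on I (\<lambda>u. - a * (h u * k u)) s
      = - a * (h s * deriv_on I k s + deriv_on I h s * k s)"
    using deriv_on_cmult[OF hk s, of "- a"] deriv_on_mult[OF h k s] by simp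
  \<comment> \<open>Second application, with components \<open>- a * (h * k)\<close> and the
    derivative of \<open>h\<close>. Fact \<open>1\<close> holds on \<open>I\<close> only, which
    suffices here.\<close>
  have "normal_connection D B (normal_connection D B X) s =
      (deriv_on I (\<lambda>u. - a * (h u * k u)) s - a * k s * deriv_on I h s) *\<^sub>R T s
      + (deriv_on I (deriv_on I h) s + a * k s * (- a * (h s * k s))) *\<^sub>R N s"
    by (intro normal_connection_TN[OF D fr _ _ 1 s a] smooth_on_mult[OF smooth_on_const]
        hk smooth_on_deriv_on h)
  also have "\<dots> = (- (a * (2 * deriv_on I h s * k s + h s * deriv_on I k s))) *\<^sub>R T s
      + (- (a\<^sup>2 * h s * (k s)\<^sup>2 - deriv_on I (deriv_on I h) s)) *\<^sub>R N s"
    unfolding 2 by (intro arg_cong2[where f = "(+)"] arg_cong2[where f = "(*\<^sub>R)"] refl)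
      (simp_all add: algebra_simps power2_eq_square)
  finally show ?thesis
    unfolding normal_laplacian_def by (simp only: scaleR_minus_left minus_add_distrib minus_minus)
qed

section \<open>Geometry of the Bertrand pair\<close>

text \<open>Differentiating \<beta> = \<alpha> + lam N and \<open>T\<^sub>\<beta>\<close> in the
  frame of \<alpha> and comparing with the Frenet equations of \<beta> yields relations for the
  speed \<open>v\<close> and for \<open>v * k\<^sub>\<beta>\<close>. The product is found directly,
  without a formula for \<open>v\<close>.\<close>

lemma bertrand_speed_times_curvature:
  assumes fa: "frenet_apparatus I \<alpha> T N B k t" and us: "unit_speed I \<alpha>"
    and fb: "frenet_apparatus I \<beta> T\<^sub>\<beta> N\<^sub>\<beta> B\<^sub>\<beta> k\<^sub>\<beta> t\<^sub>\<beta>"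
    and b: "\<And>s. s \<in> I \<Longrightarrow> \<beta> s = \<alpha> s + lam *\<^sub>R N s"
    and kt: "\<And>s. s \<in> I \<Longrightarrow> lam * k s + \<mu> * t s = 1"
    and t: "t s \<noteq> 0" and nz: "lam \<noteq> 0" "\<mu> \<noteq> 0" "sin \<theta> \<noteq> 0"
    and Tb: "\<And>s. s \<in> I \<Longrightarrow> T\<^sub>\<beta> s = cos \<theta> *\<^sub>R T s + sin \<theta> *\<^sub>R B s"
    and Nb: "\<And>s. s \<in> I \<Longrightarrow> N\<^sub>\<beta> s = N s"
    and s: "s \<in> I"
  shows "norm (deriv_on I \<beta> s) * k\<^sub>\<beta> s = (lam * k s - (sin \<theta>)\<^sup>2) / (\<mu> * sin \<theta>)"
proof -
  have sm: "smooth_on I \<alpha>" "smooth_on I T" "smooth_on I N" "smooth_on I B"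
    using fa by (auto simp: frenet_apparatus_def)
  have n: "norm (T s) = 1" "norm (N s) = 1" "T s \<bullet> N s = 0" and Bs: "B s = cross3 (T s) (N s)"
    using fa s by (auto simp: frenet_apparatus_def)
  have d\<alpha>: "deriv_on I \<alpha> s = T s" and dT: "deriv_on I T s = k s *\<^sub>R N s"
    and dN: "deriv_on I N s = - k s *\<^sub>R T s + t s *\<^sub>R B s" and dB: "deriv_on I B s = - t s *\<^sub>R N s"
    using fa us s unfolding frenet_apparatus_def unit_speed_def by force+
  define v where "v = norm (deriv_on I \<beta> s)"
  have v: "deriv_on I \<beta> s = v *\<^sub>R T\<^sub>\<beta> s" and dTb: "deriv_on I T\<^sub>\<beta> s = (v * k\<^sub>\<beta> s) *\<^sub>R N\<^sub>\<beta> s"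
    using fb s unfolding frenet_apparatus_def v_def by blast+
  have BB: "B s \<bullet> B s = 1"
    using norm_cross[of "T s" "N s"] n by (simp add: Bs power2_norm_eq_inner)
  have TB: "T s \<bullet> B s = 0" "B s \<bullet> T s = 0"
    by (simp_all add: Bs dot_cross_self)
  have TT: "T s \<bullet> T s = 1" "N s \<bullet> N s = 1"
    using n by (simp_all add: norm_eq_1)
  note df = smooth_on_differentiable[OF _ s]
  have "deriv_on I \<beta> s = deriv_on I (\<lambda>u. \<alpha> u + lam *\<^sub>R N u) s"
    by (intro deriv_on_cong b s)
  also have "\<dots> = deriv_on I \<alpha> s + deriv_on I (\<lambda>u. lam *\<^sub>R N u) s"
    by (intro deriv_on_add df sm smooth_on_scaleR smooth_on_const s)
  also have "deriv_on I (\<lambda>u. lam *\<^sub>R N u) s = lam *\<^sub>R deriv_on I N s"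
    using deriv_on_scaleR[OF df[OF smooth_on_const] df[OF sm(3)] s] by (simp add: deriv_on_const s)
  finally have e: "v *\<^sub>R (cos \<theta> *\<^sub>R T s + sin \<theta> *\<^sub>R B s)
      = T s + lam *\<^sub>R (- k s *\<^sub>R T s + t s *\<^sub>R B s)"
    by (simp add: v Tb s d\<alpha> dN)
  \<comment> \<open>The \<open>T\<close> component of the right side is
    \<open>1 - lam * k s\<close>, which is \<open>\<mu> * t s\<close>.\<close>
  have vc: "v * cos \<theta> = \<mu> * t s"
    using arg_cong[OF e, of "\<lambda>x. x \<bullet> T s"] kt[OF s] TB TT
    by (simp add: inner_add_left inner_diff_left algebra_simps)
  have vs: "v * sin \<theta> = lam * t s"
    using arg_cong[OF e, of "\<lambda>x. x \<bullet> B s"] TB BB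
    by (simp add: inner_add_left inner_diff_left algebra_simps)
  \<comment> \<open>Multiplying \<open>vc\<close> by \<open>lam\<close> and \<open>vs\<close> by
    \<mu> gives equal right sides, which eliminates the torsion.\<close>
  have "(lam * cos \<theta> - \<mu> * sin \<theta>) * v = 0"
    using vc vs by (simp add: algebra_simps)
  moreover have "v \<noteq> 0" using vs t nz by auto
  ultimately have ls: "lam * cos \<theta> = \<mu> * sin \<theta>" by simp
  have "deriv_on I T\<^sub>\<beta> s = deriv_on I (\<lambda>u. cos \<theta> *\<^sub>R T u + sin \<theta> *\<^sub>R B u) s"
    by (intro deriv_on_cong Tb s)
  also have "\<dots> = deriv_on I (\<lambda>u. cos \<theta> *\<^sub>R T u) s + deriv_on I (\<lambda>u. sin \<theta> *\<^sub>R B u) s"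
    by (intro deriv_on_add df sm smooth_on_scaleR smooth_on_const s)
  also have "deriv_on I (\<lambda>u. cos \<theta> *\<^sub>R T u) s = cos \<theta> *\<^sub>R deriv_on I T s"
    using deriv_on_scaleR[OF df[OF smooth_on_const] df[OF sm(2)] s] by (simp add: deriv_on_const s)
  also have "deriv_on I (\<lambda>u. sin \<theta> *\<^sub>R B u) s = sin \<theta> *\<^sub>R deriv_on I B s"
    using deriv_on_scaleR[OF df[OF smooth_on_const] df[OF sm(4)] s] by (simp add: deriv_on_const s)
  finally have e2: "(v * k\<^sub>\<beta> s) *\<^sub>R N s = (cos \<theta> * k s - sin \<theta> * t s) *\<^sub>R N s"
    by (simp add: dTb Nb s dT dB scaleR_diff_left)
  then have vk: "v * k\<^sub>\<beta> s = cos \<theta> * k s - sin \<theta> * t s"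
    using n by auto
  have "lam * (\<mu> * sin \<theta> * (v * k\<^sub>\<beta> s))
      = lam * ((\<mu> * sin \<theta>) * cos \<theta> * k s - (sin \<theta>)\<^sup>2 * (\<mu> * t s))"
    by (simp add: vk algebra_simps power2_eq_square)
  \<comment> \<open>\<open>ls\<close> turns \<open>\<mu> * sin \<theta>\<close> into
    \<open>lam * cos \<theta>\<close>, and \<open>kt\<close> turns \<open>\<mu> * t s\<close> into
    \<open>1 - lam * k s\<close>.\<close>
  also have "\<dots> = lam * (lam * k s * ((sin \<theta>)\<^sup>2 + (cos \<theta>)\<^sup>2) - (sin \<theta>)\<^sup>2)"
    using kt[OF s] unfolding ls[symmetric] by algebra
  finally have "\<mu> * sin \<theta> * (v * k\<^sub>\<beta> s) = lam * k s - (sin \<theta>)\<^sup>2"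
    using nz by simp
  then show ?thesis
    unfolding v_def[symmetric] using nz by (simp add: field_simps)
qed

end

section \<open>Harmonicity of the partner curve\<close>

text \<open>Inner products with \<open>x\<close> and \<open>y\<close> isolate the coefficients. It
  serves to split the harmonicity equation into its \<open>T\<close> and \<open>N\<close>
  components.\<close>

lemma orthonormal_pair_eq_iff:
  fixes x y :: "'a::real_inner"
  assumes "norm x = 1" "norm y = 1" "x \<bullet> y = 0"
  shows "a *\<^sub>R x + b *\<^sub>R y = c *\<^sub>R y \<longleftrightarrow> a = 0 \<and> b = c"
proof
  assume e: "a *\<^sub>R x + b *\<^sub>R y = c *\<^sub>R y"
  have "x \<bullet> x = 1" "y \<bullet> y = 1" "y \<bullet> x = 0"
    using assms by (simp_all add: norm_eq_1 inner_commute)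
  with arg_cong[OF e, of "\<lambda>z. z \<bullet> x"] arg_cong[OF e, of "\<lambda>z. z \<bullet> y"] assms(3)
  show "a = 0 \<and> b = c"
    by (simp add: inner_add_left)
qed simp

theorem theorem2p4:
  fixes I :: "real set"
    and \<alpha> \<beta> T N B T\<^sub>\<beta> N\<^sub>\<beta> B\<^sub>\<beta> :: "real \<Rightarrow> real^3"
    and \<kappa> \<tau> \<kappa>\<^sub>\<beta> \<tau>\<^sub>\<beta> :: "real \<Rightarrow> real"
    and lam \<mu> \<theta> :: real
    and D :: "(real \<Rightarrow> real^3) \<Rightarrow> real \<Rightarrow> real^3"
  assumes "is_interval I" and "interior I \<noteq> {}"
    and "frenet_apparatus I \<alpha> T N B \<kappa> \<tau>" and "unit_speed I \<alpha>"
    and "\<And>s. s \<in> I \<Longrightarrow> \<kappa> s > 0" and "\<And>s. s \<in> I \<Longrightarrow> \<tau> s > 0"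
    and "frenet_apparatus I \<beta> T\<^sub>\<beta> N\<^sub>\<beta> B\<^sub>\<beta> \<kappa>\<^sub>\<beta> \<tau>\<^sub>\<beta>"
    and "bertrand_pair I \<alpha> N \<beta> N\<^sub>\<beta>"
    and "\<And>s. s \<in> I \<Longrightarrow> \<beta> s = \<alpha> s + lam *\<^sub>R N s"
    and "\<And>s. s \<in> I \<Longrightarrow> lam * \<kappa> s + \<mu> * \<tau> s = 1"
    and "lam \<noteq> 0" and "\<mu> \<noteq> 0"
    and "\<And>s. s \<in> I \<Longrightarrow> T\<^sub>\<beta> s = cos \<theta> *\<^sub>R T s + sin \<theta> *\<^sub>R B s"
    and "\<And>s. s \<in> I \<Longrightarrow> N\<^sub>\<beta> s = N s"
    and "\<And>s. s \<in> I \<Longrightarrow> B\<^sub>\<beta> s = - sin \<theta> *\<^sub>R T s + cos \<theta> *\<^sub>R B s"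
    and "sin \<theta> \<noteq> 0"
    and "is_D_B I \<theta> T N B \<kappa> \<tau> D"
  shows "(weak_biharmonic I D B (mean_curvature_vector I \<beta> \<kappa>\<^sub>\<beta> N\<^sub>\<beta>) \<longleftrightarrow>
            (\<forall>s\<in>I.
               3 * lam * \<kappa> s * deriv_on I \<kappa> s - (sin \<theta>)^2 * deriv_on I \<kappa> s = 0 \<and>
               ((lam * \<kappa> s - (sin \<theta>)^2) * (1 - cos \<theta>)^2 * (\<kappa> s)^2
                  - lam * deriv_on I (deriv_on I \<kappa>) s * (sin \<theta>)^2) / (\<mu> * (sin \<theta>)^3) = 0))
       \<and> (one_type_harmonic I D B (mean_curvature_vector I \<beta> \<kappa>\<^sub>\<beta> N\<^sub>\<beta>) \<longleftrightarrow>
            (\<exists>c::real. \<forall>s\<in>I.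
               3 * lam * \<kappa> s * deriv_on I \<kappa> s - (sin \<theta>)^2 * deriv_on I \<kappa> s = 0 \<and>
               ((lam * \<kappa> s - (sin \<theta>)^2) * (1 - cos \<theta>)^2 * (\<kappa> s)^2
                  - lam * deriv_on I (deriv_on I \<kappa>) s * (sin \<theta>)^2) / (sin \<theta>)^2
                 = c * (lam * \<kappa> s - (sin \<theta>)^2)))"
proof -
  note fa = assms(3) and D = assms(17) and nz = assms(11,12,16)
  have nb: "\<forall>s\<in>I. at s within I \<noteq> bot"
    using at_within_interval_ne_bot[OF assms(1,2)] by blast
  define a where "a = (1 - cos \<theta>) / sin \<theta>"
  \<comment> \<open>If \<open>cos \<theta>\<close> were 1, then \<open>sin \<theta>\<close> would
    vanish.\<close>
  have a0: "a \<noteq> 0"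
    using nz cos_one_sin_zero[of \<theta>] by (auto simp: a_def)
  \<comment> \<open>The coefficient of the mean curvature vector, written as an affine function of
    \<kappa> so that its derivatives follow from the sum and constant-factor rules.\<close>
  define h where "h s = lam / (\<mu> * sin \<theta>) * \<kappa> s + (- sin \<theta> / \<mu>)" for s
  define H where "H = mean_curvature_vector I \<beta> \<kappa>\<^sub>\<beta> N\<^sub>\<beta>"
  have k: "smooth_on I \<kappa>"
    using fa by (simp add: frenet_apparatus_def)
  have hk: "smooth_on I (\<lambda>s. lam / (\<mu> * sin \<theta>) * \<kappa> s)"
    by (intro smooth_on_mult[OF nb] smooth_on_const[OF nb] k)
  have h: "smooth_on I h"
    unfolding h_def by (intro smooth_on_add[OF nb] smooth_on_const[OF nb] hk)
  have h_eq: "h s = (lam * \<kappa> s - (sin \<theta>)\<^sup>2) / (\<mu> * sin \<theta>)" for s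
    using nz by (simp add: h_def field_simps power2_eq_square)
  have H: "H s = h s *\<^sub>R N s" if "s \<in> I" for s
    using bertrand_speed_times_curvature[OF nb fa assms(4,7,9,10) _ nz assms(13,14) that]
      assms(6)[OF that] assms(14)[OF that]
    by (simp add: H_def mean_curvature_vector_def h_eq)
  have dh: "deriv_on I h s = lam / (\<mu> * sin \<theta>) * deriv_on I \<kappa> s" if s: "s \<in> I" for s
  proof -
    have "deriv_on I h s = deriv_on I (\<lambda>s. lam / (\<mu> * sin \<theta>) * \<kappa> s) s
        + deriv_on I (\<lambda>s. - sin \<theta> / \<mu>) s"
      unfolding h_def
      by (rule deriv_on_add[OF nb]) (intro smooth_on_differentiable smooth_on_const[OF nb] hk s)+
    also have "deriv_on I (\<lambda>s. - sin \<theta> / \<mu>) s = 0"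
      using nb s by (rule deriv_on_const)
    also have "deriv_on I (\<lambda>s. lam / (\<mu> * sin \<theta>) * \<kappa> s) s
        = lam / (\<mu> * sin \<theta>) * deriv_on I \<kappa> s"
      using nb k s by (rule deriv_on_cmult)
    finally show ?thesis by simp
  qed
  have ddh: "deriv_on I (deriv_on I h) s = lam / (\<mu> * sin \<theta>) * deriv_on I (deriv_on I \<kappa>) s"
    if "s \<in> I" for s
    by (rule trans[OF deriv_on_cong[of I "deriv_on I h", OF dh that]
        deriv_on_cmult[OF nb smooth_on_deriv_on[OF k] that]])
  \<comment> \<open>A pointwise equivalence for each \<open>c\<close> serves both claims:
    \<open>c = 0\<close> is the weak biharmonic case, and a common \<open>c\<close> for all
    \<open>s\<close> is the 1-type case.\<close>
  have main: "normal_laplacian D B H s = c *\<^sub>R H s \<longleftrightarrow>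
      3 * lam * \<kappa> s * deriv_on I \<kappa> s - (sin \<theta>)^2 * deriv_on I \<kappa> s = 0 \<and>
      ((lam * \<kappa> s - (sin \<theta>)^2) * (1 - cos \<theta>)^2 * (\<kappa> s)^2
        - lam * deriv_on I (deriv_on I \<kappa>) s * (sin \<theta>)^2) / (sin \<theta>)^2
      = c * (lam * \<kappa> s - (sin \<theta>)^2)" (is "_ \<longleftrightarrow> ?P = 0 \<and> ?Q / _ = ?R")
    if s: "s \<in> I" for s c
  proof -
    have n: "norm (T s) = 1" "norm (N s) = 1" "T s \<bullet> N s = 0"
      using fa s by (auto simp: frenet_apparatus_def)
    have L: "normal_laplacian D B H s =
        (a * (2 * deriv_on I h s * \<kappa> s + h s * deriv_on I \<kappa> s)) *\<^sub>R T s
        + (a\<^sup>2 * h s * (\<kappa> s)\<^sup>2 - deriv_on I (deriv_on I h) s) *\<^sub>R N s"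
      using H by (intro normal_laplacian_N[OF nb D fa h _ s a_def])
    \<comment> \<open>The factor 3 in \<open>?P\<close> collects 2 from the derivative of
      \<open>h\<close> and 1 from \<open>h\<close> itself.\<close>
    have 1: "a * (2 * deriv_on I h s * \<kappa> s + h s * deriv_on I \<kappa> s) = a / (\<mu> * sin \<theta>) * ?P"
      using nz by (simp add: dh[OF s] h_eq field_simps)
    have 2: "a\<^sup>2 * h s * (\<kappa> s)\<^sup>2 - deriv_on I (deriv_on I h) s
        = (?Q / (sin \<theta>)\<^sup>2) / (\<mu> * sin \<theta>)"
      using nz by (simp add: ddh[OF s] h_eq a_def divide_simps)
    have 3: "c * h s = ?R / (\<mu> * sin \<theta>)"
      by (simp add: h_eq)
    have "normal_laplacian D B H s = c *\<^sub>R H s \<longleftrightarrow>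
        a / (\<mu> * sin \<theta>) * ?P = 0 \<and> (?Q / (sin \<theta>)\<^sup>2) / (\<mu> * sin \<theta>) = ?R / (\<mu> * sin \<theta>)"
      unfolding L H[OF s] scaleR_scaleR 1 2 3
      by (rule orthonormal_pair_eq_iff[OF n])
    \<comment> \<open>Both \<open>a\<close> and \<open>\<mu> * sin \<theta>\<close> are nonzero and
      cancel.\<close>
    also have "\<dots> \<longleftrightarrow> ?P = 0 \<and> ?Q / (sin \<theta>)\<^sup>2 = ?R"
      using a0 nz by (simp only: divide_cancel_right mult_eq_0_iff divide_eq_0_iff) simp
    finally show ?thesis .
  qed
  show ?thesis
    unfolding weak_biharmonic_def one_type_harmonic_def H_def[symmetric]
    \<comment> \<open>For \<open>c = 0\<close> only the vanishing of the numerator matters, so the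
      denominators \<open>(sin \<theta>)^2\<close> and \<open>\<mu> * (sin \<theta>)^3\<close> give
      the same condition.\<close>
    by (intro conjI ex_cong1 ball_cong refl main) (use main[of _ 0] nz in simp)
qed

end
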